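(* Let $(\Omega,\mathcal{A},\mu)$ be a $\sigma$-finite measure space satisfying the following two conditions: (i) there is a countable family $\mathcal{A}_1\subset\mathcal{A}$ such that, for every $M\in\mathcal{A}$ with $\mu(M)<\infty$ and every $\varepsilon>0$, there exists $M_0\in\mathcal{A}_1$ with $\mu(M\,\Delta\,M_0)<\varepsilon$; (ii) there is a countable family $\{A_n:n\in\mathbb{N}\}\subset\mathcal{A}$ of mutually disjoint measurable sets such that $\inf_{n\in\mathbb{N}}\mu(A_n)>0$. Then $\mathcal{S}_p\setminus\mathcal{S}_m$ is $\mathfrak{c}$-dense-lineable in $L_0^{\mathbb{N}}$. In particular, $\mathcal{S}_p\setminus\bigcup_{q>0}\mathcal{S}_{L_q}$, $\mathcal{S}_p\setminus\mathcal{S}_c$, $\mathcal{S}_p\setminus\mathcal{S}_{au}$ and $\mathcal{S}_p\setminus\mathcal{S}_u$ are $\mathfrak{c}$-dense-lineable in $L_0^{\mathbb{N}}$.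
   Context: $(\Omega,\mathcal{A},\mu)$ is a positive measure space; $A\,\Delta\,B=(A\setminus B)\cup(B\setminus A)$. It is $\sigma$-finite if $\Omega$ is a countable union of measurable sets of finite measure. $L_0$ is the real vector space of ($\mu$-a.e. equality classes of) measurable functions $f:\Omega\to\mathbb{R}$, with the topology of local convergence in measure, i.e. the vector topology with a base of $0$-neighborhoods given by the sets $\{f\in L_0:\int_K\min\{1,|f|\}\,d\mu<\varepsilon\}$, $\varepsilon>0$, $K\in\mathcal{A}$, $\mu(K)<\infty$. $L_0^{\mathbb{N}}$ is the vector space of all sequences $(f_n)_{n\in\mathbb{N}}$ in $L_0$, with the product topology. Subsets of $L_0^{\mathbb{N}}$: $\mathcal{S}_p$: sequences with $f_n\to0$ pointwise almost everywhere. $\mathcal{S}_u$: $f_n\to0$ uniformly almost everywhere (there is $Z\in\mathcal{A}$ with $\mu(Z)=0$ and $f_n\to0$ uniformly on $\Omega\setminus Z$). $\mathcal{S}_{au}$: $f_n\to0$ almost uniformly (for every $\varepsilon>0$ there is $Z_\varepsilon\in\mathcal{A}$ with $\mu(Z_\varepsilon)<\varepsilon$ and $f_n\to0$ uniformly on $\Omega\setminus Z_\varepsilon$). $\mathcal{S}_m$: $f_n\to0$ in measure ($\lim_n\mu(\{|f_n|>\varepsilon\})=0$ for every $\varepsilon>0$). $\mathcal{S}_{L_q}$ ($q\in(0,+\infty)$): $\lim_n\int_\Omega|f_n|^q\,d\mu=0$. $\mathcal{S}_c$: $f_n\to0$ completely ($\sum_{n=1}^\infty\mu(\{|f_n|>\varepsilon\})<\infty$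 for every $\varepsilon>0$). $\mathfrak{c}$ is the cardinality of the continuum. A subset $A$ of a topological vector space $X$ is $\mathfrak{c}$-dense-lineable in $X$ if there is a dense vector subspace $V\subset X$ with $\dim(V)=\mathfrak{c}$ and $V\setminus\{0\}\subset A$. *)

theory Defs
  imports
    "HOL-Analysis.Analysis"
    "Jordan_Normal_Form.Missing_VectorSpace"
begin

definition real_field :: "real ring" where
  "real_field = \<lparr>carrier = UNIV, mult = (*), one = 1, zero = 0, add = (+)\<rparr>"

definition ae_rel :: "'a measure \<Rightarrow> ('a \<Rightarrow> real) rel" where
  "ae_rel M = {(f, g). f \<in> borel_measurable M \<and> g \<in> borel_measurable M \<and> (AE x in M. f x = g x)}"

definition ae_class :: "'a measure \<Rightarrow> ('a \<Rightarrow> real) \<Rightarrow> ('a \<Rightarrow> real) set" where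
  "ae_class M f = ae_rel M `` {f}"

text \<open>The record type \<open>module\<close> extends \<open>ring\<close>, so the fields \<open>mult\<close> and \<open>one\<close> have to be given;
  they play no role in the vector space structure.\<close>

definition L0 :: "'a measure \<Rightarrow> (real, ('a \<Rightarrow> real) set) module" where
  "L0 M = \<lparr>carrier = borel_measurable M // ae_rel M,
     mult = (\<lambda>F G. \<Union>f\<in>F. \<Union>g\<in>G. ae_class M (\<lambda>x. f x * g x)),
     one = ae_class M (\<lambda>x. 1),
     zero = ae_class M (\<lambda>x. 0),
     add = (\<lambda>F G. \<Union>f\<in>F. \<Union>g\<in>G. ae_class M (\<lambda>x. f x + g x)),
     smult = (\<lambda>c F. \<Union>f\<in>F. ae_class M (\<lambda>x. c * f x))\<rparr>"

definition seq_space :: "('k, 'b) module \<Rightarrow> ('k, nat \<Rightarrow> 'b) module" where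
  "seq_space V = \<lparr>carrier = {F. \<forall>n. F n \<in> carrier V},
     mult = (\<lambda>F G n. F n \<otimes>\<^bsub>V\<^esub> G n),
     one = (\<lambda>n. \<one>\<^bsub>V\<^esub>),
     zero = (\<lambda>n. \<zero>\<^bsub>V\<^esub>),
     add = (\<lambda>F G n. F n \<oplus>\<^bsub>V\<^esub> G n),
     smult = (\<lambda>c F n. c \<odot>\<^bsub>V\<^esub> F n)\<rparr>"

text \<open>The vector topology with the base \<open>L0_zero_nhd M K \<epsilon>\<close> of 0-neighbourhoods: \<open>U\<close> is open iff with
  every point \<open>F\<close> it contains a translate \<open>F + N\<close> of a basic 0-neighbourhood \<open>N\<close>.\<close>

definition L0_zero_nhd :: "'a measure \<Rightarrow> 'a set \<Rightarrow> real \<Rightarrow> ('a \<Rightarrow> real) set set" where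
  "L0_zero_nhd M K \<epsilon> =
     {ae_class M f | f. f \<in> borel_measurable M \<and> (LINT x:K|M. min 1 \<bar>f x\<bar>) < \<epsilon>}"

definition L0_open :: "'a measure \<Rightarrow> ('a \<Rightarrow> real) set set \<Rightarrow> bool" where
  "L0_open M U \<longleftrightarrow> U \<subseteq> carrier (L0 M) \<and>
     (\<forall>F\<in>U. \<exists>K \<epsilon>. K \<in> sets M \<and> emeasure M K < \<infinity> \<and> 0 < \<epsilon> \<and>
        (\<forall>G \<in> L0_zero_nhd M K \<epsilon>. F \<oplus>\<^bsub>L0 M\<^esub> G \<in> U))"

definition L0_topology :: "'a measure \<Rightarrow> ('a \<Rightarrow> real) set topology" where
  "L0_topology M = topology (L0_open M)"

definition L0_seq_topology :: "'a measure \<Rightarrow> (nat \<Rightarrow> ('a \<Rightarrow> real) set) topology" where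
  "L0_seq_topology M = product_topology (\<lambda>_. L0_topology M) UNIV"

text \<open>The sets of sequences of classes below are the images of the corresponding sets of sequences of
  functions. All modes of convergence are invariant under changing each \<open>f n\<close> on a null set.
  Measures and integrals are taken in \<open>ennreal\<close>, so finitely many terms may be infinite in
  \<open>S_m\<close> and \<open>S_L\<close>.\<close>

definition seq_class :: "'a measure \<Rightarrow> (nat \<Rightarrow> 'a \<Rightarrow> real) \<Rightarrow> nat \<Rightarrow> ('a \<Rightarrow> real) set" where
  "seq_class M f = (\<lambda>n. ae_class M (f n))"

definition S_p :: "'a measure \<Rightarrow> (nat \<Rightarrow> ('a \<Rightarrow> real) set) set" where
  "S_p M = {seq_class M f | f. (\<forall>n. f n \<in> borel_measurable M) \<and>
     (AE x in M. (\<lambda>n. f n x) \<longlonglongrightarrow> 0)}"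

definition S_u :: "'a measure \<Rightarrow> (nat \<Rightarrow> ('a \<Rightarrow> real) set) set" where
  "S_u M = {seq_class M f | f. (\<forall>n. f n \<in> borel_measurable M) \<and>
     (\<exists>Z \<in> sets M. emeasure M Z = 0 \<and> uniform_limit (space M - Z) f (\<lambda>x. 0) sequentially)}"

definition S_au :: "'a measure \<Rightarrow> (nat \<Rightarrow> ('a \<Rightarrow> real) set) set" where
  "S_au M = {seq_class M f | f. (\<forall>n. f n \<in> borel_measurable M) \<and>
     (\<forall>\<epsilon>::real. 0 < \<epsilon> \<longrightarrow> (\<exists>Z \<in> sets M. emeasure M Z < ennreal \<epsilon> \<and>
        uniform_limit (space M - Z) f (\<lambda>x. 0) sequentially))}"

definition S_m :: "'a measure \<Rightarrow> (nat \<Rightarrow> ('a \<Rightarrow> real) set) set" where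
  "S_m M = {seq_class M f | f. (\<forall>n. f n \<in> borel_measurable M) \<and>
     (\<forall>\<epsilon>::real. 0 < \<epsilon> \<longrightarrow> (\<lambda>n. emeasure M {x \<in> space M. \<bar>f n x\<bar> > \<epsilon>}) \<longlonglongrightarrow> 0)}"

definition S_L :: "real \<Rightarrow> 'a measure \<Rightarrow> (nat \<Rightarrow> ('a \<Rightarrow> real) set) set" where
  "S_L q M = {seq_class M f | f. (\<forall>n. f n \<in> borel_measurable M) \<and>
     (\<lambda>n. \<integral>\<^sup>+x. ennreal (\<bar>f n x\<bar> powr q) \<partial>M) \<longlonglongrightarrow> 0}"

definition S_c :: "'a measure \<Rightarrow> (nat \<Rightarrow> ('a \<Rightarrow> real) set) set" where
  "S_c M = {seq_class M f | f. (\<forall>n. f n \<in> borel_measurable M) \<and>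
     (\<forall>\<epsilon>::real. 0 < \<epsilon> \<longrightarrow> (\<Sum>n. emeasure M {x \<in> space M. \<bar>f n x\<bar> > \<epsilon>}) < \<infinity>)}"

text \<open>The library dimension \<open>vectorspace.dim\<close> is a natural number, so infinite dimension is
  expressed by the cardinality of a Hamel basis.\<close>

definition continuum_dim :: "('k, 'k1) ring_scheme \<Rightarrow> ('k, 'v, 'v1) module_scheme \<Rightarrow> bool" where
  "continuum_dim K V \<longleftrightarrow> (\<exists>B. vectorspace.basis K V B \<and> B \<approx> (UNIV :: real set))"

definition c_dense_lineable ::
    "'v set \<Rightarrow> (real, 'v) module \<Rightarrow> 'v topology \<Rightarrow> bool" where
  "c_dense_lineable A X T \<longleftrightarrow>
     (\<exists>V. VectorSpace.subspace real_field V X \<and> Abstract_Topology.closure_of T V = topspace T \<and>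
          continuum_dim real_field (X\<lparr>carrier := V\<rparr>) \<and> V - {\<zero>\<^bsub>X\<^esub>} \<subseteq> A)"

lemma field_real_field: "field real_field"
proof -
  have "\<exists>y. x + y = 0 \<and> y + x = 0" for x :: real by (rule exI[of _ "- x"]) simp
  moreover have "\<exists>y. x * y = 1 \<and> y * x = 1" if "x \<noteq> 0" for x :: real
    by (rule exI[of _ "inverse x"]) (use that in simp)
  ultimately show ?thesis
    by unfold_locales (auto simp: real_field_def Units_def algebra_simps)
qed

lemma equiv_ae_rel: "equiv (borel_measurable M) (ae_rel M)"
proof (rule equivI)
  show "ae_rel M \<subseteq> borel_measurable M \<times> borel_measurable M" by (auto simp: ae_rel_def)
  show "refl_on (borel_measurable M) (ae_rel M)" by (auto simp: refl_on_def ae_rel_def)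
  show "sym (ae_rel M)"
  proof (rule symI)
    fix f g assume "(f, g) \<in> ae_rel M"
    then have "f \<in> borel_measurable M" "g \<in> borel_measurable M"
      and fg: "AE x in M. f x = g x"
      by (auto simp: ae_rel_def)
    moreover have "AE x in M. g x = f x" using fg by eventually_elim simp
    ultimately show "(g, f) \<in> ae_rel M" by (simp add: ae_rel_def)
  qed
  show "trans (ae_rel M)"
  proof (rule transI)
    fix f g h assume "(f, g) \<in> ae_rel M" "(g, h) \<in> ae_rel M"
    then have "f \<in> borel_measurable M" "h \<in> borel_measurable M"
      and fg: "AE x in M. f x = g x" and gh: "AE x in M. g x = h x"
      by (auto simp: ae_rel_def)
    moreover have "AE x in M. f x = h x" using fg gh by eventually_elim simp
    ultimately show "(f, h) \<in> ae_rel M" by (simp add: ae_rel_def)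
  qed
qed

lemma ae_class_eq_iff:
  "f \<in> borel_measurable M \<Longrightarrow> g \<in> borel_measurable M \<Longrightarrow>
    ae_class M f = ae_class M g \<longleftrightarrow> (AE x in M. f x = g x)"
  unfolding ae_class_def using eq_equiv_class_iff[OF equiv_ae_rel, of f M g]
  by (auto simp: ae_rel_def)

lemma mem_ae_class:
  "g \<in> ae_class M f \<longleftrightarrow>
    f \<in> borel_measurable M \<and> g \<in> borel_measurable M \<and> (AE x in M. f x = g x)"
  by (auto simp: ae_class_def ae_rel_def)

lemma ae_class_in_L0: "f \<in> borel_measurable M \<Longrightarrow> ae_class M f \<in> carrier (L0 M)"
  by (auto simp: L0_def ae_class_def quotientI)

lemma L0_cases:
  assumes "F \<in> carrier (L0 M)"
  obtains f where "f \<in> borel_measurable M" "F = ae_class M f"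
  using assms by (auto simp: L0_def ae_class_def elim: quotientE)

lemma L0_zero: "\<zero>\<^bsub>L0 M\<^esub> = ae_class M (\<lambda>x. 0)"
  by (simp add: L0_def)

lemma L0_add:
  assumes [measurable]: "f \<in> borel_measurable M" "g \<in> borel_measurable M"
  shows "ae_class M f \<oplus>\<^bsub>L0 M\<^esub> ae_class M g = ae_class M (\<lambda>x. f x + g x)"
proof -
  have eq: "ae_class M (\<lambda>x. f' x + g' x) = ae_class M (\<lambda>x. f x + g x)"
    if "f' \<in> ae_class M f" "g' \<in> ae_class M g" for f' g'
  proof -
    have [measurable]: "f' \<in> borel_measurable M" "g' \<in> borel_measurable M"
      and ae: "AE x in M. f x = f' x" "AE x in M. g x = g' x"
      using that by (auto simp: mem_ae_class)
    have "AE x in M. f' x + g' x = f x + g x" using ae by eventually_elim simp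
    then show ?thesis by (subst ae_class_eq_iff) auto
  qed
  have "f \<in> ae_class M f" "g \<in> ae_class M g" using assms by (auto simp: mem_ae_class)
  moreover have "ae_class M f \<oplus>\<^bsub>L0 M\<^esub> ae_class M g =
      (\<Union>f'\<in>ae_class M f. \<Union>g'\<in>ae_class M g. ae_class M (\<lambda>x. f x + g x))"
    unfolding L0_def module.simps ring.simps by (intro SUP_cong refl eq)
  ultimately show ?thesis by auto
qed

lemma L0_smult:
  assumes [measurable]: "f \<in> borel_measurable M"
  shows "c \<odot>\<^bsub>L0 M\<^esub> ae_class M f = ae_class M (\<lambda>x. c * f x)"
proof -
  have eq: "ae_class M (\<lambda>x. c * f' x) = ae_class M (\<lambda>x. c * f x)" if "f' \<in> ae_class M f" for f'
  proof -
    have [measurable]: "f' \<in> borel_measurable M"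
      and ae: "AE x in M. f x = f' x" using that by (auto simp: mem_ae_class)
    have "AE x in M. c * f' x = c * f x" using ae by eventually_elim simp
    then show ?thesis by (subst ae_class_eq_iff) auto
  qed
  have "f \<in> ae_class M f" using assms by (auto simp: mem_ae_class)
  moreover have "c \<odot>\<^bsub>L0 M\<^esub> ae_class M f = (\<Union>f'\<in>ae_class M f. ae_class M (\<lambda>x. c * f x))"
    unfolding L0_def module.simps ring.simps by (intro SUP_cong refl eq)
  ultimately show ?thesis by auto
qed

lemma vectorspace_L0: "vectorspace real_field (L0 M)"
proof -
  interpret R: field real_field by (rule field_real_field)
  have ab: "abelian_group (L0 M)"
  proof (rule abelian_groupI)
    fix x assume "x \<in> carrier (L0 M)"
    then obtain f where f[measurable]: "f \<in> borel_measurable M" and x: "x = ae_class M f"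
      by (rule L0_cases)
    show "\<exists>y\<in>carrier (L0 M). y \<oplus>\<^bsub>L0 M\<^esub> x = \<zero>\<^bsub>L0 M\<^esub>"
      by (rule bexI[of _ "ae_class M (\<lambda>x. - f x)"])
        (simp_all add: x L0_add L0_zero ae_class_in_L0)
  qed ((elim L0_cases)?; simp add: L0_add L0_zero ae_class_in_L0 ac_simps)+
  have "module real_field (L0 M)"
    by (rule moduleI[OF R.is_cring ab])
      (elim L0_cases; simp add: L0_add L0_smult ae_class_in_L0 real_field_def algebra_simps)+
  then show ?thesis by (simp add: vectorspace_def R.field_axioms)
qed

lemma vectorspace_seq_space:
  assumes "vectorspace K V"
  shows "vectorspace K (seq_space V)"
proof -
  interpret V: vectorspace K V by fact
  have ab: "abelian_group (seq_space V)"
  proof (rule abelian_groupI)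
    fix x assume "x \<in> carrier (seq_space V)"
    then show "\<exists>y\<in>carrier (seq_space V). y \<oplus>\<^bsub>seq_space V\<^esub> x = \<zero>\<^bsub>seq_space V\<^esub>"
      by (intro bexI[of _ "\<lambda>n. \<ominus>\<^bsub>V\<^esub> x n"]) (auto simp: seq_space_def V.M.l_neg)
  qed (auto simp: seq_space_def V.M.a_ac)
  have "module K (seq_space V)"
    by (rule moduleI[OF V.R.is_cring ab])
      (auto simp: seq_space_def V.smult_l_distr V.smult_r_distr V.smult_assoc1)
  then show ?thesis by (simp add: vectorspace_def V.field_axioms)
qed

lemma L0_zero_nhd_mono:
  assumes "K \<in> sets M" "L \<in> sets M" "emeasure M L < \<infinity>" "K \<subseteq> L" "\<delta> \<le> \<epsilon>"
  shows "L0_zero_nhd M L \<delta> \<subseteq> L0_zero_nhd M K \<epsilon>"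
proof -
  have "(LINT x:K|M. min 1 \<bar>f x\<bar>) \<le> (LINT x:L|M. min 1 \<bar>f x\<bar>)"
    if [measurable]: "f \<in> borel_measurable M" for f :: "_ \<Rightarrow> real"
  proof -
    have "emeasure M K < \<infinity>"
      using emeasure_mono[OF \<open>K \<subseteq> L\<close> \<open>L \<in> sets M\<close>] assms(3) by order
    note fin = this assms(3)
    have int: "integrable M (\<lambda>x. indicat_real A x *\<^sub>R min 1 \<bar>f x\<bar>)"
      if [measurable]: "A \<in> sets M" and "emeasure M A < \<infinity>" for A
    proof (rule Bochner_Integration.integrable_bound)
      show "integrable M (indicat_real A)" using that by simp
    qed (auto simp: indicator_def)
    show ?thesis unfolding set_lebesgue_integral_def
      by (rule integral_mono) (use assms fin int in \<open>auto simp: indicator_def\<close>)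
  qed
  then show ?thesis using \<open>\<delta> \<le> \<epsilon>\<close> unfolding L0_zero_nhd_def by force
qed

lemma istopology_L0_open: "istopology (L0_open M)"
  unfolding istopology_def
proof (intro conjI allI impI)
  fix S T assume ST: "L0_open M S" "L0_open M T"
  show "L0_open M (S \<inter> T)" unfolding L0_open_def
  proof (intro conjI ballI)
    fix F assume "F \<in> S \<inter> T"
    with ST obtain K1 e1 K2 e2 where
      1: "K1 \<in> sets M" "emeasure M K1 < \<infinity>" "0 < e1" "\<forall>G \<in> L0_zero_nhd M K1 e1. F \<oplus>\<^bsub>L0 M\<^esub> G \<in> S"
      and 2: "K2 \<in> sets M" "emeasure M K2 < \<infinity>" "0 < e2" "\<forall>G \<in> L0_zero_nhd M K2 e2. F \<oplus>\<^bsub>L0 M\<^esub> G \<in> T"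
      unfolding L0_open_def by (metis IntE)
    have fin: "emeasure M (K1 \<union> K2) < \<infinity>"
      using emeasure_subadditive[OF 1(1) 2(1)] 1(2) 2(2)
      by (metis ennreal_add_less_top infinity_ennreal_def order_le_less_trans)
    have "L0_zero_nhd M (K1 \<union> K2) (min e1 e2) \<subseteq> L0_zero_nhd M K1 e1"
      "L0_zero_nhd M (K1 \<union> K2) (min e1 e2) \<subseteq> L0_zero_nhd M K2 e2"
      by (rule L0_zero_nhd_mono; use 1 2 fin in simp)+
    then show "\<exists>K \<epsilon>. K \<in> sets M \<and> emeasure M K < \<infinity> \<and> 0 < \<epsilon> \<and>
        (\<forall>G \<in> L0_zero_nhd M K \<epsilon>. F \<oplus>\<^bsub>L0 M\<^esub> G \<in> S \<inter> T)"
      using 1 2 fin by (intro exI[of _ "K1 \<union> K2"] exI[of _ "min e1 e2"]) auto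
  qed (use ST in \<open>auto simp: L0_open_def\<close>)
next
  fix \<K> assume "\<forall>K\<in>\<K>. L0_open M K"
  then show "L0_open M (\<Union>\<K>)" unfolding L0_open_def by (meson Sup_le_iff UnionE UnionI)
qed

lemma openin_L0_topology: "openin (L0_topology M) = L0_open M"
  by (simp add: L0_topology_def istopology_L0_open)

lemma topspace_L0_topology: "topspace (L0_topology M) = carrier (L0 M)"
proof -
  interpret vectorspace real_field "L0 M" by (rule vectorspace_L0)
  have "L0_open M (carrier (L0 M))" unfolding L0_open_def
    by (auto intro!: exI[of _ "{}"] exI[of _ "1::real"] simp: L0_zero_nhd_def ae_class_in_L0)
  then show ?thesis unfolding topspace_def openin_L0_topology
    by (auto simp: L0_open_def)
qed

lemma topspace_L0_seq_topology: "topspace (L0_seq_topology M) = carrier (seq_space (L0 M))"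
  by (auto simp: L0_seq_topology_def topspace_L0_topology seq_space_def PiE_UNIV_domain)

end

theory Submission
  imports Defs
begin

text \<open>Let \<open>D\<close> be a countable dense set of step functions in \<open>L0\<close>, and let \<open>L\<close> map the real numbers onto the
  countable set of finite lists over \<open>D\<close>. To a real \<open>t\<close> we attach the sequence that starts with \<open>L t\<close> and
  continues with \<open>(1 + exp t) ^ n\<close> times the indicator of \<open>A n\<close>. Since a basic open set of the product
  topology restricts only finitely many terms, these sequences are already dense. The tail of a
  nontrivial linear combination is a multiple of the indicator of \<open>A n\<close> whose coefficient is
  unbounded, being dominated by the largest base: it tends to 0 pointwise, as the \<open>A n\<close> are disjoint,
  but not in measure, as their measures are bounded below. This also gives linear independence, so
  the span of the sequences has dimension continuum. All other modes of convergence imply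
  convergence in measure.\<close>

section \<open>Separability of local convergence in measure\<close>

text \<open>Lists of pairs make countability immediate: lists over a countable set are countable.
  The sets in a list may overlap or repeat, so addition of step functions is concatenation of
  lists.\<close>

definition rational_step :: "(rat \<times> 'a set) list \<Rightarrow> 'a \<Rightarrow> real" where
  "rational_step xs x = (\<Sum>(q, S)\<leftarrow>xs. of_rat q * indicator S x)"

lemma rational_step_append: "rational_step (xs @ ys) x = rational_step xs x + rational_step ys x"
  by (simp add: rational_step_def)

lemma borel_measurable_rational_step:
  assumes "snd ` set xs \<subseteq> sets M"
  shows "rational_step xs \<in> borel_measurable M"
  using assms
proof (induction xs)
  case Nil
  show ?case by (simp add: rational_step_def[abs_def])
next
  case (Cons p xs)
  obtain q S where p: "p = (q, S)" by fastforce
  then have [measurable]: "S \<in> sets M" "rational_step xs \<in> borel_measurable M"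
    using Cons by auto
  have "rational_step (p # xs) = (\<lambda>x. of_rat q * indicator S x + rational_step xs x)"
    by (simp add: fun_eq_iff rational_step_def p)
  then show ?case by simp
qed

lemma set_integrable_min_one:
  assumes "K \<in> sets M" "emeasure M K < \<infinity>" "f \<in> borel_measurable M"
  shows "set_integrable M K (\<lambda>x. min 1 \<bar>f x :: real\<bar>)"
  unfolding set_integrable_def
proof (rule Bochner_Integration.integrable_bound)
  show "integrable M (indicat_real K)" using assms by simp
qed (use assms in \<open>auto simp: indicator_def\<close>)

text \<open>Truncation at 1 is subadditive on nonnegative reals. Applied to differences, this is the
  triangle inequality for the pseudometric that measures local convergence on
  \<open>K\<close>.\<close>

lemma set_integral_min_one_triangle:
  assumes "K \<in> sets M" "emeasure M K < \<infinity>"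
    and "f \<in> borel_measurable M" "g \<in> borel_measurable M" "h \<in> borel_measurable M"
    and le: "\<And>x. x \<in> K \<Longrightarrow> \<bar>f x\<bar> \<le> \<bar>g x\<bar> + \<bar>h x\<bar>"
  shows "(LINT x:K|M. min 1 \<bar>f x :: real\<bar>) \<le> (LINT x:K|M. min 1 \<bar>g x\<bar>) + (LINT x:K|M. min 1 \<bar>h x\<bar>)"
proof -
  note int = set_integrable_min_one[OF assms(1,2)]
  have "(LINT x:K|M. min 1 \<bar>f x\<bar>) \<le> (LINT x:K|M. min 1 \<bar>g x\<bar> + min 1 \<bar>h x\<bar>)"
    by (rule set_integral_mono) (use assms int set_integral_add(1) le in \<open>fastforce+\<close>)
  then show ?thesis using set_integral_add(2)[OF int int] assms by simp
qed

text \<open>With \<open>K\<close> fixed, this is the closure of the rational step functions over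
  \<A> for the pseudometric of \<open>K\<close>. The next lemmas enlarge the class from indicators
  to simple functions to all measurable functions.\<close>

definition step_approximable :: "'a measure \<Rightarrow> 'a set set \<Rightarrow> 'a set \<Rightarrow> ('a \<Rightarrow> real) \<Rightarrow> bool" where
  "step_approximable M \<A> K f \<longleftrightarrow> f \<in> borel_measurable M \<and>
     (\<forall>\<epsilon>>0. \<exists>xs. snd ` set xs \<subseteq> \<A> \<and> (LINT x:K|M. min 1 \<bar>f x - rational_step xs x\<bar>) < \<epsilon>)"

lemma step_approximable_add:
  assumes K: "K \<in> sets M" "emeasure M K < \<infinity>" and \<A>: "\<A> \<subseteq> sets M"
    and f: "step_approximable M \<A> K f" and g: "step_approximable M \<A> K g"
  shows "step_approximable M \<A> K (\<lambda>x. f x + g x)"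
  unfolding step_approximable_def
proof (intro conjI allI impI)
  have [measurable]: "f \<in> borel_measurable M" "g \<in> borel_measurable M"
    using f g by (auto simp: step_approximable_def)
  show "(\<lambda>x. f x + g x) \<in> borel_measurable M" by simp
  fix \<epsilon> :: real assume "\<epsilon> > 0"
  then have "\<epsilon> / 2 > 0" by simp
  then obtain xs ys where xs: "snd ` set xs \<subseteq> \<A>" and ys: "snd ` set ys \<subseteq> \<A>"
    and fx: "(LINT x:K|M. min 1 \<bar>f x - rational_step xs x\<bar>) < \<epsilon> / 2"
    and gy: "(LINT x:K|M. min 1 \<bar>g x - rational_step ys x\<bar>) < \<epsilon> / 2"
    using f g unfolding step_approximable_def by meson
  have [measurable]: "rational_step xs \<in> borel_measurable M" "rational_step ys \<in> borel_measurable M"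
    using xs ys \<A> by (meson borel_measurable_rational_step order_trans)+
  have "(LINT x:K|M. min 1 \<bar>f x + g x - rational_step (xs @ ys) x\<bar>)
      \<le> (LINT x:K|M. min 1 \<bar>f x - rational_step xs x\<bar>) + (LINT x:K|M. min 1 \<bar>g x - rational_step ys x\<bar>)"
    unfolding rational_step_append by (rule set_integral_min_one_triangle) (use K in auto)
  with fx gy have "(LINT x:K|M. min 1 \<bar>f x + g x - rational_step (xs @ ys) x\<bar>) < \<epsilon>" by simp
  with xs ys show "\<exists>xs. snd ` set xs \<subseteq> \<A> \<and>
      (LINT x:K|M. min 1 \<bar>f x + g x - rational_step xs x\<bar>) < \<epsilon>"
    by (intro exI[of _ "xs @ ys"]) auto
qed

text \<open>Replace \<open>y\<close> by a nearby rational \<open>q\<close> and the part of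
  \<open>S\<close> inside \<open>K\<close> by a nearby \<open>T\<close> from \<A>. On
  \<open>K\<close>, the truncated error is at most \<delta> where the two sets agree and at most 1
  on their symmetric difference \<open>E\<close>, which has small measure.\<close>

lemma step_approximable_indicator:
  assumes K: "K \<in> sets M" "emeasure M K < \<infinity>" and \<A>: "\<A> \<subseteq> sets M"
    and dense: "\<And>S \<epsilon>::real. S \<in> sets M \<Longrightarrow> emeasure M S < \<infinity> \<Longrightarrow> 0 < \<epsilon> \<Longrightarrow>
      \<exists>S\<^sub>0 \<in> \<A>. emeasure M (sym_diff S S\<^sub>0) < ennreal \<epsilon>"
    and S: "S \<in> sets M"
  shows "step_approximable M \<A> K (\<lambda>x. y * indicator S x)"
  unfolding step_approximable_def
proof (intro conjI allI impI)
  note [measurable] = S K(1)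
  show "(\<lambda>x. y * indicator S x) \<in> borel_measurable M" by simp
  fix \<epsilon> :: real assume \<epsilon>: "\<epsilon> > 0"
  define m where "m = measure M K"
  have m: "m \<ge> 0" by (simp add: m_def)
  \<comment> \<open>This makes the contribution of \<open>K\<close> less than half of \<epsilon>;
    the summand 1 in the denominator covers the case of measure zero.\<close>
  define \<delta> where "\<delta> = \<epsilon> / (2 * (m + 1))"
  have \<delta>: "\<delta> > 0" using \<epsilon> m by (simp add: \<delta>_def)
  have "\<delta> * m < \<epsilon> / 2" using \<epsilon> m by (simp add: \<delta>_def field_simps)
  obtain q where "y < of_rat q" "of_rat q < y + \<delta>" using of_rat_dense[of y "y + \<delta>"] \<delta> by auto
  then have q: "\<bar>y - of_rat q\<bar> \<le> \<delta>" by simp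
  \<comment> \<open>\<open>S\<close> itself may have infinite measure, whereas the density
    hypothesis speaks of sets of finite measure only; what happens outside \<open>K\<close> does not
    affect the integral.\<close>
  have "emeasure M (S \<inter> K) \<le> emeasure M K" by (rule emeasure_mono) auto
  then have "emeasure M (S \<inter> K) < \<infinity>" using K(2) by order
  then obtain T where T: "T \<in> \<A>" and d: "emeasure M (sym_diff (S \<inter> K) T) < ennreal (\<epsilon> / 2)"
    using dense[of "S \<inter> K" "\<epsilon> / 2"] \<epsilon> by auto
  have [measurable]: "T \<in> sets M" using T \<A> by auto
  define E where "E = sym_diff (S \<inter> K) T"
  have [measurable]: "E \<in> sets M" by (simp add: E_def)
  have fE: "emeasure M E < \<infinity>" using d unfolding E_def[symmetric] by (simp add: order_less_trans)
  have mE: "measure M E < \<epsilon> / 2" 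
    using d \<epsilon> unfolding E_def[symmetric] measure_def
    by (metis enn2real_less_iff fE infinity_ennreal_def)
  have rs: "rational_step [(q, T)] x = of_rat q * indicator T x" for x
    by (simp add: rational_step_def)
  have "(LINT x:K|M. min 1 \<bar>y * indicator S x - rational_step [(q, T)] x\<bar>)
     \<le> (LINT x|M. \<delta> * indicator K x + indicator E x)"
    unfolding set_lebesgue_integral_def
  proof (rule integral_mono)
    show "integrable M (\<lambda>x. indicat_real K x *\<^sub>R min 1 \<bar>y * indicat_real S x - rational_step [(q, T)] x\<bar>)"
      using set_integrable_min_one[OF K, of "\<lambda>x. y * indicat_real S x - rational_step [(q, T)] x"]
      unfolding set_integrable_def rs by simp
    show "integrable M (\<lambda>x. \<delta> * indicat_real K x + indicat_real E x)"
      using K(2) fE by simp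
    show "indicat_real K x *\<^sub>R min 1 \<bar>y * indicat_real S x - rational_step [(q, T)] x\<bar>
        \<le> \<delta> * indicat_real K x + indicat_real E x" for x
      using q \<delta> unfolding rs by (auto simp: E_def indicator_def min_le_iff_disj)
  qed
  also have "\<dots> = \<delta> * m + measure M E" using K(2) fE by (simp add: m_def)
  also have "\<dots> < \<epsilon>" using mE \<open>\<delta> * m < \<epsilon> / 2\<close> by simp
  finally show "\<exists>xs. snd ` set xs \<subseteq> \<A> \<and>
      (LINT x:K|M. min 1 \<bar>y * indicator S x - rational_step xs x\<bar>) < \<epsilon>"
    using T by (intro exI[of _ "[(q, T)]"]) auto
qed

lemma step_approximable_simple_function:
  assumes K: "K \<in> sets M" "emeasure M K < \<infinity>" and \<A>: "\<A> \<subseteq> sets M"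
    and dense: "\<And>S \<epsilon>::real. S \<in> sets M \<Longrightarrow> emeasure M S < \<infinity> \<Longrightarrow> 0 < \<epsilon> \<Longrightarrow>
      \<exists>S\<^sub>0 \<in> \<A>. emeasure M (sym_diff S S\<^sub>0) < ennreal \<epsilon>"
    and f: "simple_function M f"
  shows "step_approximable M \<A> K f"
proof -
  have *: "step_approximable M \<A> K (\<lambda>x. \<Sum>y\<in>Y. y * indicator (f -` {y} \<inter> space M) x)"
    if "finite Y" for Y :: "real set"
    using that
  proof induction
    case empty
    show ?case using step_approximable_indicator[OF K \<A> dense, of "{}" 0] by simp
  next
    case (insert y Y)
    have "f -` {y} \<inter> space M \<in> sets M" using f by (rule simple_functionD)
    then show ?case
      unfolding sum.insert[OF insert.hyps]
      by (intro step_approximable_add[OF K \<A> step_approximable_indicator[OF K \<A> dense] insert.IH])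
  qed
  define g where "g x = (\<Sum>y\<in>f ` space M. y * indicator (f -` {y} \<inter> space M) x)" for x
  have eq: "f x = g x" if "x \<in> space M" for x
    unfolding g_def
    by (rule trans[OF simple_function_indicator_representation_banach[OF f that]]) (simp add: mult.commute)
  have "K \<subseteq> space M" using K sets.sets_into_space by auto
  \<comment> \<open>The decomposition into level sets is valid only on \<open>space M\<close>, which
    suffices because the integral ranges over \<open>K\<close>.\<close>
  then have "(LINT x:K|M. min 1 \<bar>f x - h x\<bar>) = (LINT x:K|M. min 1 \<bar>g x - h x\<bar>)" for h
    by (intro set_lebesgue_integral_cong) (use K eq in auto)
  then show ?thesis using *[OF simple_functionD(1)[OF f]] borel_measurable_simple_function[OF f]
    unfolding step_approximable_def g_def[symmetric, abs_def] by simp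
qed

text \<open>Simple functions converge pointwise to \<open>f\<close>. Thanks to the truncation at 1,
  the indicator of \<open>K\<close> dominates all the errors, so dominated convergence applies
  whether or not \<open>f\<close> is integrable.\<close>

lemma step_approximable_borel_measurable:
  assumes K: "K \<in> sets M" "emeasure M K < \<infinity>" and \<A>: "\<A> \<subseteq> sets M"
    and dense: "\<And>S \<epsilon>::real. S \<in> sets M \<Longrightarrow> emeasure M S < \<infinity> \<Longrightarrow> 0 < \<epsilon> \<Longrightarrow>
      \<exists>S\<^sub>0 \<in> \<A>. emeasure M (sym_diff S S\<^sub>0) < ennreal \<epsilon>"
    and f: "f \<in> borel_measurable M"
  shows "step_approximable M \<A> K f"
  unfolding step_approximable_def
proof (intro conjI allI impI f)
  note [measurable] = f K(1)
  fix \<epsilon> :: real assume "\<epsilon> > 0"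
  then have \<epsilon>: "\<epsilon> / 2 > 0" by simp
  obtain s where s: "\<And>i. simple_function M (s i)" and lim: "\<And>x. x \<in> space M \<Longrightarrow> (\<lambda>i. s i x) \<longlonglongrightarrow> f x"
    using borel_measurable_implies_sequence_metric[OF f, of 0] by blast
  have [measurable]: "s i \<in> borel_measurable M" for i
    using s by (rule borel_measurable_simple_function)
  have "(\<lambda>i. LINT x:K|M. min 1 \<bar>f x - s i x\<bar>) \<longlonglongrightarrow> (LINT x|M. 0)"
    unfolding set_lebesgue_integral_def
  proof (rule integral_dominated_convergence[where w = "indicat_real K"])
    show "AE x in M. (\<lambda>i. indicat_real K x *\<^sub>R min 1 \<bar>f x - s i x\<bar>) \<longlonglongrightarrow> 0"
    proof (rule AE_I2)
      fix x assume "x \<in> space M"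
      then have "(\<lambda>i. indicat_real K x *\<^sub>R min 1 \<bar>f x - s i x\<bar>) \<longlonglongrightarrow> indicat_real K x *\<^sub>R min 1 \<bar>f x - f x\<bar>"
        by (intro tendsto_intros lim)
      then show "(\<lambda>i. indicat_real K x *\<^sub>R min 1 \<bar>f x - s i x\<bar>) \<longlonglongrightarrow> 0" by simp
    qed
  qed (use K(2) in \<open>auto simp: indicator_def\<close>)
  then have "eventually (\<lambda>i. (LINT x:K|M. min 1 \<bar>f x - s i x\<bar>) < \<epsilon> / 2) sequentially"
    using \<epsilon> by (intro order_tendstoD(2)) auto
  then obtain i where i: "(LINT x:K|M. min 1 \<bar>f x - s i x\<bar>) < \<epsilon> / 2"
    by (auto dest: eventually_happens)
  obtain xs where xs: "snd ` set xs \<subseteq> \<A>"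
    and sx: "(LINT x:K|M. min 1 \<bar>s i x - rational_step xs x\<bar>) < \<epsilon> / 2"
    using step_approximable_simple_function[OF K \<A> dense s, of i] \<epsilon>
    unfolding step_approximable_def by blast
  have [measurable]: "rational_step xs \<in> borel_measurable M"
    using xs \<A> by (meson borel_measurable_rational_step order_trans)
  have "(LINT x:K|M. min 1 \<bar>f x - rational_step xs x\<bar>)
      \<le> (LINT x:K|M. min 1 \<bar>f x - s i x\<bar>) + (LINT x:K|M. min 1 \<bar>s i x - rational_step xs x\<bar>)"
    by (rule set_integral_min_one_triangle) (use K in auto)
  with i sx xs show "\<exists>xs. snd ` set xs \<subseteq> \<A> \<and> (LINT x:K|M. min 1 \<bar>f x - rational_step xs x\<bar>) < \<epsilon>"
    by (intro exI[of _ xs]) auto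
qed

section \<open>A countable dense set of step functions\<close>

definition L0_dense_set :: "'a measure \<Rightarrow> ('a \<Rightarrow> real) set \<Rightarrow> bool" where
  "L0_dense_set M D \<longleftrightarrow> D \<subseteq> borel_measurable M \<and>
     (\<forall>U. L0_open M U \<longrightarrow> U \<noteq> {} \<longrightarrow> (\<exists>d\<in>D. ae_class M d \<in> U))"

lemma exists_countable_L0_dense_set:
  fixes M :: "'a measure"
  assumes c: "countable \<A>" and \<A>: "\<A> \<subseteq> sets M"
    and dense: "\<And>S \<epsilon>::real. S \<in> sets M \<Longrightarrow> emeasure M S < \<infinity> \<Longrightarrow> 0 < \<epsilon> \<Longrightarrow>
      \<exists>S\<^sub>0 \<in> \<A>. emeasure M (sym_diff S S\<^sub>0) < ennreal \<epsilon>"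
  shows "\<exists>D. countable D \<and> L0_dense_set M D"
proof (intro exI conjI)
  let ?D = "rational_step ` lists (UNIV \<times> \<A>)"
  have mem: "xs \<in> lists (UNIV \<times> \<A>) \<longleftrightarrow> snd ` set xs \<subseteq> \<A>" for xs :: "(rat \<times> 'a set) list"
    by (auto simp: lists_eq_set)
  show "countable ?D" using c by (intro countable_image countable_lists countable_SIGMA) auto
  show "L0_dense_set M ?D"
    unfolding L0_dense_set_def
  proof (intro conjI allI impI)
    show "?D \<subseteq> borel_measurable M"
    proof (rule image_subsetI)
      fix xs :: "(rat \<times> 'a set) list" assume "xs \<in> lists (UNIV \<times> \<A>)"
      then have "snd ` set xs \<subseteq> sets M" unfolding mem using \<A> by (rule order_trans)
      then show "rational_step xs \<in> borel_measurable M" by (rule borel_measurable_rational_step)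
    qed
    fix U assume U: "L0_open M U" "U \<noteq> {}"
    then obtain F where F: "F \<in> U" by auto
    then have "F \<in> carrier (L0 M)" using U by (auto simp: L0_open_def)
    then obtain f where [measurable]: "f \<in> borel_measurable M" and Ff: "F = ae_class M f"
      by (rule L0_cases)
    obtain K \<epsilon> where K: "K \<in> sets M" "emeasure M K < \<infinity>" and \<epsilon>: "0 < \<epsilon>"
      and nhd: "\<And>G. G \<in> L0_zero_nhd M K \<epsilon> \<Longrightarrow> F \<oplus>\<^bsub>L0 M\<^esub> G \<in> U"
      using U F unfolding L0_open_def by meson
    obtain xs where xs: "snd ` set xs \<subseteq> \<A>"
      and fx: "(LINT x:K|M. min 1 \<bar>f x - rational_step xs x\<bar>) < \<epsilon>"
      using step_approximable_borel_measurable[OF K \<A> dense, of f] \<epsilon>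
      unfolding step_approximable_def by auto
    have [measurable]: "rational_step xs \<in> borel_measurable M"
      using xs \<A> by (meson borel_measurable_rational_step order_trans)
    \<comment> \<open>The class of the step function is \<open>F\<close> plus this difference, so it
      lies in the translated neighbourhood inside \<open>U\<close>.\<close>
    have "ae_class M (\<lambda>x. rational_step xs x - f x) \<in> L0_zero_nhd M K \<epsilon>"
      using fx unfolding L0_zero_nhd_def
      by (auto intro!: exI[of _ "\<lambda>x. rational_step xs x - f x"] simp: abs_minus_commute)
    then have "ae_class M (rational_step xs) \<in> U" using nhd by (fastforce simp: Ff L0_add)
    then show "\<exists>d\<in>?D. ae_class M d \<in> U" using xs mem[of xs] by blast
  qed
qed

section \<open>Inclusions between the modes of convergence\<close>

lemma S_mI:
  assumes "\<And>n. f n \<in> borel_measurable M"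
    and "\<And>\<epsilon>::real. 0 < \<epsilon> \<Longrightarrow> (\<lambda>n. emeasure M {x \<in> space M. \<bar>f n x\<bar> > \<epsilon>}) \<longlonglongrightarrow> 0"
  shows "seq_class M f \<in> S_m M"
  using assms unfolding S_m_def by auto

text \<open>The terms of a convergent series tend to 0.\<close>

lemma S_c_subset_S_m: "S_c M \<subseteq> S_m M"
proof
  fix F assume "F \<in> S_c M"
  then obtain f where f: "\<And>n. f n \<in> borel_measurable M" "F = seq_class M f"
    and s: "\<And>\<epsilon>::real. 0 < \<epsilon> \<Longrightarrow> (\<Sum>n. emeasure M {x \<in> space M. \<bar>f n x\<bar> > \<epsilon>}) < \<infinity>"
    unfolding S_c_def by auto
  have "(\<lambda>n. emeasure M {x \<in> space M. \<bar>f n x\<bar> > \<epsilon>}) \<longlonglongrightarrow> 0" if "0 < \<epsilon>" for \<epsilon> :: real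
  proof -
    define a where "a n = emeasure M {x \<in> space M. \<bar>f n x\<bar> > \<epsilon>}" for n
    \<comment> \<open>A finite sum rules out infinite terms, so the series can be treated as a
      series of real numbers.\<close>
    have sa: "suminf a \<noteq> \<infinity>" using s[OF that] unfolding a_def[abs_def] by (metis order_less_irrefl)
    have fin: "a n \<noteq> \<infinity>" for n using ennreal_suminf_lessD[of a \<infinity> n] sa by (auto simp: less_top)
    have a: "ennreal (enn2real (a n)) = a n" for n
      using fin[of n] by (simp add: less_top)
    have "summable (\<lambda>n. enn2real (a n))"
      by (rule summable_suminf_not_top) (use sa in \<open>simp_all add: a\<close>)
    then have "(\<lambda>n. ennreal (enn2real (a n))) \<longlonglongrightarrow> ennreal 0"
      by (intro tendsto_ennrealI summable_LIMSEQ_zero)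
    then show ?thesis unfolding a by (simp add: a_def)
  qed
  then show "F \<in> S_m M" using f by (auto intro: S_mI)
qed

text \<open>This is Markov's inequality for the \<open>q\<close>-th power of the absolute
  value.\<close>

lemma S_L_subset_S_m:
  assumes q: "0 < q"
  shows "S_L q M \<subseteq> S_m M"
proof
  fix F assume "F \<in> S_L q M"
  then obtain f where [measurable]: "\<And>n. f n \<in> borel_measurable M" and F: "F = seq_class M f"
    and lim: "(\<lambda>n. \<integral>\<^sup>+x. ennreal (\<bar>f n x\<bar> powr q) \<partial>M) \<longlonglongrightarrow> 0"
    unfolding S_L_def by auto
  have "(\<lambda>n. emeasure M {x \<in> space M. \<bar>f n x\<bar> > \<epsilon>}) \<longlonglongrightarrow> 0" if \<epsilon>: "0 < \<epsilon>" for \<epsilon> :: real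
  proof (rule tendsto_sandwich[OF _ _ tendsto_const])
    let ?c = "ennreal (1 / \<epsilon> powr q)"
    have "emeasure M {x \<in> space M. \<bar>f n x\<bar> > \<epsilon>} \<le> ?c * (\<integral>\<^sup>+x. ennreal (\<bar>f n x\<bar> powr q) \<partial>M)" for n
    proof -
      have "emeasure M {x \<in> space M. \<bar>f n x\<bar> > \<epsilon>}
          \<le> emeasure M {x \<in> space M. 1 \<le> ?c * ennreal (\<bar>f n x\<bar> powr q)}"
      proof (rule emeasure_mono)
        have "1 \<le> ?c * ennreal (\<bar>y\<bar> powr q)" if "\<bar>y\<bar> > \<epsilon>" for y :: real
        proof -
          have "\<epsilon> powr q \<le> \<bar>y\<bar> powr q" using that \<epsilon> q by (intro powr_mono2) auto
          then have "1 \<le> 1 / \<epsilon> powr q * \<bar>y\<bar> powr q" using \<epsilon> by (simp add: field_simps)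
          then have "ennreal 1 \<le> ennreal (1 / \<epsilon> powr q * \<bar>y\<bar> powr q)" by (rule ennreal_leI)
          also have "\<dots> = ?c * ennreal (\<bar>y\<bar> powr q)" by (rule ennreal_mult) auto
          finally show ?thesis by simp
        qed
        then show "{x \<in> space M. \<bar>f n x\<bar> > \<epsilon>} \<subseteq> {x \<in> space M. 1 \<le> ?c * ennreal (\<bar>f n x\<bar> powr q)}"
          by auto
      qed simp
      also have "\<dots> \<le> ?c * (\<integral>\<^sup>+x. ennreal (\<bar>f n x\<bar> powr q) * indicator (space M) x \<partial>M)"
        by (rule nn_integral_Markov_inequality) auto
      also have "(\<integral>\<^sup>+x. ennreal (\<bar>f n x\<bar> powr q) * indicator (space M) x \<partial>M) = (\<integral>\<^sup>+x. ennreal (\<bar>f n x\<bar> powr q) \<partial>M)"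
        by (rule nn_integral_cong) simp
      finally show ?thesis .
    qed
    then show "\<forall>\<^sub>F n in sequentially. emeasure M {x \<in> space M. \<bar>f n x\<bar> > \<epsilon>}
        \<le> ?c * (\<integral>\<^sup>+x. ennreal (\<bar>f n x\<bar> powr q) \<partial>M)" by simp
    show "(\<lambda>n. ?c * (\<integral>\<^sup>+x. ennreal (\<bar>f n x\<bar> powr q) \<partial>M)) \<longlonglongrightarrow> 0"
      using ennreal_tendsto_cmult[OF _ lim, of ?c] by simp
  qed auto
  then show "F \<in> S_m M" using F by (auto intro: S_mI)
qed

text \<open>Off a set \<open>Z\<close> of small measure all late terms are below \<epsilon> in
  absolute value, so the set where \<epsilon> is exceeded is contained in \<open>Z\<close>.\<close>

lemma S_au_subset_S_m: "S_au M \<subseteq> S_m M"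
proof
  fix F assume "F \<in> S_au M"
  then obtain f where f[measurable]: "\<And>n. f n \<in> borel_measurable M" and F: "F = seq_class M f"
    and au: "\<And>\<epsilon>::real. 0 < \<epsilon> \<Longrightarrow> \<exists>Z \<in> sets M. emeasure M Z < ennreal \<epsilon> \<and>
        uniform_limit (space M - Z) f (\<lambda>x. 0) sequentially"
    unfolding S_au_def by auto
  have "(\<lambda>n. emeasure M {x \<in> space M. \<bar>f n x\<bar> > \<epsilon>}) \<longlonglongrightarrow> 0" if \<epsilon>: "0 < \<epsilon>" for \<epsilon> :: real
  proof (rule order_tendstoI)
    fix a :: ennreal assume "a > 0"
    \<comment> \<open>The bound \<open>a\<close> may be infinite, while almost uniform convergence
      is stated with real bounds.\<close>
    then obtain \<delta> :: real where "0 < \<delta>" "ennreal \<delta> < a"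
      by (metis dense ennreal_cases ennreal_less_zero_iff less_top_ennreal order_less_le_trans top_greatest)
    with au[of \<delta>] obtain Z where Z: "Z \<in> sets M" "emeasure M Z < a"
      and u: "uniform_limit (space M - Z) f (\<lambda>x. 0) sequentially"
      by (meson order_less_trans)
    have "\<forall>\<^sub>F n in sequentially. \<forall>x\<in>space M - Z. dist (f n x) 0 < \<epsilon>"
      by (rule uniform_limitD[OF u \<epsilon>])
    then show "\<forall>\<^sub>F n in sequentially. emeasure M {x \<in> space M. \<bar>f n x\<bar> > \<epsilon>} < a"
    proof eventually_elim
      case (elim n)
      then have "{x \<in> space M. \<bar>f n x\<bar> > \<epsilon>} \<subseteq> Z" by force
      then have "emeasure M {x \<in> space M. \<bar>f n x\<bar> > \<epsilon>} \<le> emeasure M Z" using Z by (intro emeasure_mono)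
      then show ?case using Z by order
    qed
  qed simp
  then show "F \<in> S_m M" using F f by (auto intro: S_mI)
qed

lemma S_u_subset_S_au: "S_u M \<subseteq> S_au M"
proof
  fix F assume "F \<in> S_u M"
  then obtain f Z where f: "\<And>n. f n \<in> borel_measurable M" "F = seq_class M f"
    and Z: "Z \<in> sets M" "emeasure M Z = 0" "uniform_limit (space M - Z) f (\<lambda>x. 0) sequentially"
    unfolding S_u_def by auto
  have "\<exists>Z \<in> sets M. emeasure M Z < ennreal \<epsilon> \<and> uniform_limit (space M - Z) f (\<lambda>x. 0) sequentially"
    if "0 < \<epsilon>" for \<epsilon> :: real
    using Z that by (intro bexI[of _ Z]) auto
  then show "F \<in> S_au M" using f unfolding S_au_def by blast
qed

lemma c_dense_lineable_mono: "c_dense_lineable A X T \<Longrightarrow> A \<subseteq> B \<Longrightarrow> c_dense_lineable B X T"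
  unfolding c_dense_lineable_def by (meson order_trans)

section \<open>The lineable family\<close>

text \<open>Divide by the power of the largest base \<open>b s\<close> that has a nonzero
  coefficient: the quotient tends to \<open>c s\<close>, and the power itself tends to
  infinity.\<close>

lemma sum_exponentials_at_top:
  fixes b c :: "'t \<Rightarrow> real"
  assumes T: "finite T" and inj: "inj_on b T" and b: "\<And>t. t \<in> T \<Longrightarrow> 1 < b t"
    and nz: "\<exists>t\<in>T. c t \<noteq> 0"
  shows "filterlim (\<lambda>n. \<bar>\<Sum>t\<in>T. c t * b t ^ n\<bar>) at_top sequentially"
proof -
  \<comment> \<open>The largest base in \<open>T\<close> might have coefficient 0, so vanishing
    coefficients are discarded before the maximum is taken.\<close>
  define T' where "T' = {t\<in>T. c t \<noteq> 0}"
  have T': "finite T'" "T' \<noteq> {}" using T nz by (auto simp: T'_def)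
  obtain s where s: "s \<in> T'" and max: "\<And>t. t \<in> T' \<Longrightarrow> b t \<le> b s"
    using Max_in[of "b ` T'"] Max_ge[of "b ` T'"] T' by (metis (no_types, lifting) finite_imageI image_iff image_is_empty)
  have bs: "b s > 1" and cs: "c s \<noteq> 0" using s b by (auto simp: T'_def)
  have "(\<lambda>n. c t * (b t / b s) ^ n) \<longlonglongrightarrow> (if t = s then c s else 0)" if t: "t \<in> T'" for t
  proof (cases "t = s")
    case False
    then have "b t < b s" "b t > 1"
      using max[OF t] inj t s b by (auto simp: T'_def inj_on_def order_less_le)
    then have "(\<lambda>n. (b t / b s) ^ n) \<longlonglongrightarrow> 0" by (intro LIMSEQ_realpow_zero) auto
    then show ?thesis using False tendsto_mult_right_zero by simp
  qed (use bs in simp)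
  then have "(\<lambda>n. \<Sum>t\<in>T'. c t * (b t / b s) ^ n) \<longlonglongrightarrow> (\<Sum>t\<in>T'. if t = s then c s else 0)"
    by (intro tendsto_sum)
  then have "(\<lambda>n. \<bar>\<Sum>t\<in>T'. c t * (b t / b s) ^ n\<bar>) \<longlonglongrightarrow> \<bar>c s\<bar>"
    using T' s by (simp add: tendsto_rabs)
  moreover have "filterlim (\<lambda>n. b s ^ n) at_top sequentially"
    using bs filterlim_realpow_sequentially_gt1[of "b s"]
    by (intro filterlim_at_infinity_imp_filterlim_at_top) auto
  ultimately have "filterlim (\<lambda>n. \<bar>\<Sum>t\<in>T'. c t * (b t / b s) ^ n\<bar> * b s ^ n) at_top sequentially"
    using cs by (intro filterlim_tendsto_pos_mult_at_top) auto
  moreover have "\<bar>\<Sum>t\<in>T'. c t * (b t / b s) ^ n\<bar> * b s ^ n = \<bar>\<Sum>t\<in>T. c t * b t ^ n\<bar>" for n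
  proof -
    have "\<bar>\<Sum>t\<in>T'. c t * (b t / b s) ^ n\<bar> * b s ^ n = \<bar>(\<Sum>t\<in>T'. c t * (b t / b s) ^ n) * b s ^ n\<bar>"
      using bs by (simp add: abs_mult)
    also have "(\<Sum>t\<in>T'. c t * (b t / b s) ^ n) * b s ^ n = (\<Sum>t\<in>T'. c t * b t ^ n)"
      using bs by (simp add: sum_distrib_right power_divide)
    also have "\<dots> = (\<Sum>t\<in>T. c t * b t ^ n)"
      by (rule sum.mono_neutral_left) (use T in \<open>auto simp: T'_def\<close>)
    finally show ?thesis .
  qed
  ultimately show ?thesis by simp
qed

text \<open>The bases \<open>1 + exp t\<close> exceed 1 and are distinct for distinct
  \<open>t\<close>, as \<open>sum_exponentials_at_top\<close> requires.\<close>

definition bump_seq :: "(nat \<Rightarrow> 'a set) \<Rightarrow> (real \<Rightarrow> ('a \<Rightarrow> real) list) \<Rightarrow> real \<Rightarrow> nat \<Rightarrow> 'a \<Rightarrow> real" where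
  "bump_seq A L t n =
     (if n < length (L t) then L t ! n else (\<lambda>x. (1 + exp t) ^ n * indicator (A n) x))"

lemma borel_measurable_bump_seq:
  assumes "range A \<subseteq> sets M" "set (L t) \<subseteq> borel_measurable M"
  shows "bump_seq A L t n \<in> borel_measurable M"
proof -
  have [measurable]: "A n \<in> sets M" using assms by auto
  show ?thesis using assms(2) by (auto simp: bump_seq_def)
qed

text \<open>Finitely many initial lists have bounded length; beyond that bound only the tails
  contribute, and they share the indicator of \<open>A n\<close>.\<close>

lemma eventually_sum_bump_seq:
  assumes "finite T"
  shows "\<forall>\<^sub>F n in sequentially. \<forall>x. (\<Sum>t\<in>T. c t * bump_seq A L t n x)
    = (\<Sum>t\<in>T. c t * (1 + exp t) ^ n) * indicator (A n) x"
proof -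
  have "\<forall>\<^sub>F n in sequentially. \<forall>t\<in>T. length (L t) \<le> n"
    using assms eventually_ge_at_top by (intro eventually_ball_finite) auto
  then show ?thesis
    by eventually_elim (auto simp: bump_seq_def sum_distrib_right not_less mult.assoc intro!: sum.cong)
qed

text \<open>Each point lies in at most one of the disjoint sets \<open>A n\<close>, so at each point
  the combination is eventually 0, however fast the coefficients grow.\<close>

lemma sum_bump_seq_in_S_p:
  assumes A: "range A \<subseteq> sets M" "disjoint_family A" and L: "\<And>t. set (L t) \<subseteq> borel_measurable M"
    and T: "finite T"
  shows "seq_class M (\<lambda>n x. \<Sum>t\<in>T. c t * bump_seq A L t n x) \<in> S_p M"
proof -
  note [measurable] = borel_measurable_bump_seq[OF A(1) L]
  have "(\<lambda>n. \<Sum>t\<in>T. c t * bump_seq A L t n x) \<longlonglongrightarrow> 0" for x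
  proof -
    have "\<forall>\<^sub>F n in sequentially. x \<notin> A n"
    proof (cases "\<exists>m. x \<in> A m")
      case True
      then obtain m where "x \<in> A m" by auto
      then have "x \<notin> A n" if "n > m" for n
        using disjoint_family_onD[OF A(2), of m n] that by auto
      then show ?thesis by (rule eventually_mono[OF eventually_gt_at_top])
    qed simp
    with eventually_sum_bump_seq[OF T, of c A L]
    have "\<forall>\<^sub>F n in sequentially. (\<Sum>t\<in>T. c t * bump_seq A L t n x) = 0"
      by eventually_elim simp
    then show ?thesis by (rule tendsto_eventually)
  qed
  then show ?thesis unfolding S_p_def by (auto intro!: exI[of _ "\<lambda>n x. \<Sum>t\<in>T. c t * bump_seq A L t n x"])
qed

text \<open>For large \<open>n\<close> the coefficient exceeds 1 in absolute value, so the set where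
  the combination exceeds 1 contains \<open>A n\<close>, and its measure is at least the positive
  infimum.\<close>

lemma sum_bump_seq_notin_S_m:
  assumes A: "range A \<subseteq> sets M" "0 < (INF n. emeasure M (A n))" and L: "\<And>t. set (L t) \<subseteq> borel_measurable M"
    and T: "finite T" and nz: "\<exists>t\<in>T. c t \<noteq> 0"
  shows "seq_class M (\<lambda>n x. \<Sum>t\<in>T. c t * bump_seq A L t n x) \<notin> S_m M"
proof
  note [measurable] = borel_measurable_bump_seq[OF A(1) L]
  define g where "g n x = (\<Sum>t\<in>T. c t * bump_seq A L t n x)" for n x
  have [measurable]: "g n \<in> borel_measurable M" for n by (simp add: g_def[abs_def])
  assume "seq_class M (\<lambda>n x. \<Sum>t\<in>T. c t * bump_seq A L t n x) \<in> S_m M"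
  \<comment> \<open>Membership in \<open>S_m\<close> only provides some sequence of representatives
    \<open>f\<close>; the measures are carried over from \<open>g\<close> by equality almost
    everywhere.\<close>
  then obtain f where f[measurable]: "\<And>n. f n \<in> borel_measurable M" and eq: "seq_class M g = seq_class M f"
    and lim: "\<And>\<epsilon>::real. 0 < \<epsilon> \<Longrightarrow> (\<lambda>n. emeasure M {x \<in> space M. \<bar>f n x\<bar> > \<epsilon>}) \<longlonglongrightarrow> 0"
    unfolding S_m_def g_def[abs_def] by auto
  have ae: "AE x in M. g n x = f n x" for n
    using fun_cong[OF eq, of n] by (simp add: seq_class_def ae_class_eq_iff)
  define \<mu> where "\<mu> = (INF n. emeasure M (A n))"
  have "\<forall>\<^sub>F n in sequentially. emeasure M {x \<in> space M. \<bar>f n x\<bar> > 1} < \<mu>"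
    using lim[of 1] A(2) by (intro order_tendstoD(2)) (auto simp: \<mu>_def)
  moreover have "\<forall>\<^sub>F n in sequentially. \<bar>\<Sum>t\<in>T. c t * (1 + exp t) ^ n\<bar> > 1"
    by (rule filterlim_at_top_dense[THEN iffD1, rule_format, OF sum_exponentials_at_top])
      (use T nz in \<open>auto simp: inj_on_def\<close>)
  moreover note eventually_sum_bump_seq[OF T, of c A L]
  ultimately have "\<forall>\<^sub>F n in sequentially. False"
  proof eventually_elim
    case (elim n)
    have An[measurable]: "A n \<in> sets M" using A(1) by auto
    have "A n \<subseteq> {x \<in> space M. \<bar>g n x\<bar> > 1}"
      using elim(2,3) sets.sets_into_space[OF An] by (auto simp: g_def)
    then have "emeasure M (A n) \<le> emeasure M {x \<in> space M. \<bar>g n x\<bar> > 1}"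
      by (rule emeasure_mono) simp
    also have "\<dots> = emeasure M {x \<in> space M. \<bar>f n x\<bar> > 1}"
      by (rule emeasure_eq_AE) (use ae[of n] in auto)
    also have "\<dots> < \<mu>" by (rule elim(1))
    also have "\<mu> \<le> emeasure M (A n)" unfolding \<mu>_def by (rule INF_lower) simp
    finally show False by simp
  qed
  then show False by simp
qed

section \<open>Linear combinations in the sequence space\<close>

lemma seq_class_zero_in_S_m: "seq_class M (\<lambda>n x. 0) \<in> S_m M"
  by (rule S_mI) auto

lemma zero_seq_space_L0: "\<zero>\<^bsub>seq_space (L0 M)\<^esub> = seq_class M (\<lambda>n x. 0)"
  by (simp add: seq_space_def seq_class_def L0_zero)

lemma seq_class_in_seq_space:
  "(\<And>n. f n \<in> borel_measurable M) \<Longrightarrow> seq_class M f \<in> carrier (seq_space (L0 M))"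
  by (simp add: seq_space_def seq_class_def ae_class_in_L0)

text \<open>This translates the abstract linear combination, indexed by a set of vectors, into a
  pointwise sum over parameters. Injectivity ensures that no two parameters collapse to one
  vector.\<close>

lemma lincomb_seq_class:
  assumes g: "\<And>t n. g t n \<in> borel_measurable M"
    and T: "finite T" and inj: "inj_on (\<lambda>t. seq_class M (g t)) T"
  shows "module.lincomb (seq_space (L0 M)) a ((\<lambda>t. seq_class M (g t)) ` T)
    = seq_class M (\<lambda>n x. \<Sum>t\<in>T. a (seq_class M (g t)) * g t n x)"
proof -
  interpret V: vectorspace real_field "seq_space (L0 M)"
    by (intro vectorspace_seq_space vectorspace_L0)
  note [measurable] = g
  have car: "seq_class M (g t) \<in> carrier (seq_space (L0 M))" for t
    by (rule seq_class_in_seq_space) simp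
  show ?thesis using T inj
  proof induction
    case empty
    show ?case by (simp add: V.lincomb_def zero_seq_space_L0)
  next
    case (insert t T)
    let ?G = "\<lambda>t. seq_class M (g t)"
    have "V.lincomb a (?G ` insert t T) = V.lincomb a (?G ` T \<union> {?G t})" by simp
    also have "\<dots> = a (?G t) \<odot>\<^bsub>seq_space (L0 M)\<^esub> ?G t \<oplus>\<^bsub>seq_space (L0 M)\<^esub> V.lincomb a (?G ` T)"
      by (rule V.lincomb_insert)
        (use insert car in \<open>auto simp: real_field_def\<close>)
    also have "V.lincomb a (?G ` T) = seq_class M (\<lambda>n x. \<Sum>t\<in>T. a (?G t) * g t n x)"
      using insert by auto
    also have "a (?G t) \<odot>\<^bsub>seq_space (L0 M)\<^esub> ?G t \<oplus>\<^bsub>seq_space (L0 M)\<^esub> \<dots>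
        = seq_class M (\<lambda>n x. \<Sum>t\<in>insert t T. a (?G t) * g t n x)"
      using insert.hyps by (auto simp: seq_space_def seq_class_def L0_smult L0_add)
    finally show ?case .
  qed
qed

section \<open>Density of the generators and properties of their span\<close>

lemma exists_surj_real:
  assumes "countable C" "C \<noteq> {}"
  shows "\<exists>L :: real \<Rightarrow> 'c. range L = C"
proof
  \<comment> \<open>The reals are first mapped onto the natural numbers, which then enumerate
    \<open>C\<close>; repetitions are harmless.\<close>
  have "range (\<lambda>t::real. nat \<lfloor>t\<rfloor>) = UNIV"
    by (auto simp: surj_def intro!: exI[of _ "real _"])
  then have "range (\<lambda>t::real. from_nat_into C (nat \<lfloor>t\<rfloor>)) = range (from_nat_into C)"
    by (metis image_image)
  then show "range (\<lambda>t::real. from_nat_into C (nat \<lfloor>t\<rfloor>)) = C"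
    using range_from_nat_into[OF assms(2,1)] by simp
qed

text \<open>A basic open box inside \<open>U\<close> constrains only coordinates below some
  \<open>N\<close>. Choosing an element of \<open>D\<close> in each of these factors gives the list;
  later terms are free.\<close>

lemma L0_seq_topology_meets_prescribed_initial_terms:
  assumes D: "L0_dense_set M D" and U: "openin (L0_seq_topology M) U" "F \<in> U"
  shows "\<exists>ds\<in>lists D. \<forall>f. (\<forall>n. f n \<in> borel_measurable M) \<longrightarrow>
    (\<forall>n<length ds. f n = ds ! n) \<longrightarrow> seq_class M f \<in> U"
proof -
  obtain W where fin: "finite {i. W i \<noteq> topspace (L0_topology M)}"
    and W: "\<And>i. L0_open M (W i)" and F: "F \<in> PiE UNIV W" and sub: "PiE UNIV W \<subseteq> U"
    using U unfolding L0_seq_topology_def openin_product_topology_alt openin_L0_topology by auto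
  obtain N where N: "\<And>i. W i \<noteq> topspace (L0_topology M) \<Longrightarrow> i < N"
    using finite_nat_set_iff_bounded[THEN iffD1, OF fin] by auto
  have "\<exists>d\<in>D. ae_class M d \<in> W i" for i
    using D W[of i] F unfolding L0_dense_set_def by (metis PiE_mem UNIV_I empty_iff)
  then obtain d where d: "\<And>i. d i \<in> D" "\<And>i. ae_class M (d i) \<in> W i" by metis
  show ?thesis
  proof (intro bexI[of _ "map d [0..<N]"] allI impI)
    fix f assume f: "\<forall>n. f n \<in> borel_measurable M" "\<forall>n<length (map d [0..<N]). f n = map d [0..<N] ! n"
    have "ae_class M (f n) \<in> W n" for n
    proof (cases "n < N")
      case True
      then show ?thesis using f(2) d(2)[of n] by simp
    next
      case False
      then have "W n = carrier (L0 M)" using N topspace_L0_topology by metis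
      then show ?thesis using f(1) by (simp add: ae_class_in_L0)
    qed
    then show "seq_class M f \<in> U" using sub by (auto simp: seq_class_def PiE_UNIV_domain)
  qed (use d in auto)
qed

lemma c_dense_lineable_S_p_minus_S_m:
  fixes M :: "'a measure" and A :: "nat \<Rightarrow> 'a set"
  assumes c: "countable \<A>" and \<A>: "\<A> \<subseteq> sets M"
    and dense: "\<And>S \<epsilon>::real. S \<in> sets M \<Longrightarrow> emeasure M S < \<infinity> \<Longrightarrow> 0 < \<epsilon> \<Longrightarrow>
      \<exists>S\<^sub>0 \<in> \<A>. emeasure M (sym_diff S S\<^sub>0) < ennreal \<epsilon>"
    and A: "range A \<subseteq> sets M" "disjoint_family A" "0 < (INF n. emeasure M (A n))"
  shows "c_dense_lineable (S_p M - S_m M) (seq_space (L0 M)) (L0_seq_topology M)"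
proof -
  interpret V: vectorspace real_field "seq_space (L0 M)"
    by (intro vectorspace_seq_space vectorspace_L0)
  obtain D where D: "countable D" "L0_dense_set M D"
    using exists_countable_L0_dense_set[OF c \<A> dense] by auto
  \<comment> \<open>Every list must occur, but \<open>L\<close> need not be injective: distinct
    parameters are told apart by their tails.\<close>
  obtain L :: "real \<Rightarrow> ('a \<Rightarrow> real) list" where rL: "range L = lists D"
    using exists_surj_real[of "lists D"] D(1) by auto
  have L: "\<And>t. set (L t) \<subseteq> borel_measurable M"
  proof -
    fix t
    have "L t \<in> lists D" using rL by blast
    then show "set (L t) \<subseteq> borel_measurable M" using D(2) by (auto simp: L0_dense_set_def)
  qed
  note meas = borel_measurable_bump_seq[OF A(1) L]
  define G where "G t = seq_class M (bump_seq A L t)" for t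
  have car: "range G \<subseteq> carrier (seq_space (L0 M))"
    unfolding G_def using meas by (auto intro: seq_class_in_seq_space)
  have injG: "inj G"
  proof (rule injI, rule ccontr)
    fix s t assume st: "G s = G t" "s \<noteq> t"
    \<comment> \<open>With these coefficients the combination is the difference of the two
      sequences. It would be the zero class, although a nontrivial combination cannot lie in
      \<open>S_m\<close>.\<close>
    define c where "c r = (if r = s then 1 else - 1 :: real)" for r
    have "seq_class M (\<lambda>n x. \<Sum>r\<in>{s, t}. c r * bump_seq A L r n x) = seq_class M (\<lambda>n x. 0)"
      unfolding seq_class_def
    proof
      fix n
      have "AE x in M. bump_seq A L s n x = bump_seq A L t n x"
        using fun_cong[OF st(1), of n] by (simp add: G_def seq_class_def ae_class_eq_iff meas)
      then have "AE x in M. (\<Sum>r\<in>{s, t}. c r * bump_seq A L r n x) = 0"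
        using st(2) by (auto simp: c_def)
      then show "ae_class M (\<lambda>x. \<Sum>r\<in>{s, t}. c r * bump_seq A L r n x) = ae_class M (\<lambda>x. 0)"
        using meas by (subst ae_class_eq_iff) auto
    qed
    moreover have "seq_class M (\<lambda>n x. \<Sum>r\<in>{s, t}. c r * bump_seq A L r n x) \<notin> S_m M"
      by (rule sum_bump_seq_notin_S_m) (use A L in \<open>auto simp: c_def\<close>)
    ultimately show False using seq_class_zero_in_S_m by metis
  qed
  have lincomb: "V.lincomb a (G ` T) \<in> S_p M - S_m M"
    if "finite T" "\<exists>t\<in>T. a (G t) \<noteq> 0" for a T
  proof -
    have "V.lincomb a (G ` T) = seq_class M (\<lambda>n x. \<Sum>t\<in>T. a (G t) * bump_seq A L t n x)"
      using lincomb_seq_class[of "bump_seq A L" M T a] meas that(1) injG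
      unfolding G_def by (auto simp: inj_on_def inj_def)
    then show ?thesis
      using sum_bump_seq_in_S_p[of A M L T "\<lambda>t. a (G t)"] sum_bump_seq_notin_S_m[of A M L T "\<lambda>t. a (G t)"] A L that
      by simp
  qed
  have zero: "\<zero>\<^bsub>seq_space (L0 M)\<^esub> \<in> S_m M" by (simp add: zero_seq_space_L0 seq_class_zero_in_S_m)
  \<comment> \<open>A vanishing nontrivial combination would put the zero sequence outside
    \<open>S_m\<close>.\<close>
  have indep: "V.lin_indpt (range G)"
  proof
    assume "V.lin_dep (range G)"
    then obtain B a v where B: "finite B" "B \<subseteq> range G" "V.lincomb a B = \<zero>\<^bsub>seq_space (L0 M)\<^esub>"
      "v \<in> B" "a v \<noteq> 0"
      unfolding V.lin_dep_def by (auto simp: real_field_def)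
    obtain T where T: "B = G ` T" "finite T"
      using finite_subset_image[OF B(1,2)] by auto
    then have "V.lincomb a B \<in> S_p M - S_m M" using lincomb[of T a] B by auto
    then show False using B(3) zero by simp
  qed
  define W where "W = V.span (range G)"
  have sub: "VectorSpace.subspace real_field W (seq_space (L0 M))"
    unfolding W_def by (rule V.span_is_subspace[OF car])
  then have smod: "submodule real_field W (seq_space (L0 M))" by (simp add: subspace_def)
  have GW: "range G \<subseteq> W" unfolding W_def by (rule V.in_own_span[OF car])
  interpret W: vectorspace real_field "seq_space (L0 M)\<lparr>carrier := W\<rparr>"
    by (rule V.subspace_is_vs[OF sub])
  have "W.basis (range G)"
    unfolding W.basis_def using V.span_li_not_depend[OF GW smod] indep GW by (simp add: W_def)
  \<comment> \<open>Injectivity of \<open>G\<close> gives the basis exactly the cardinality of the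
    real numbers.\<close>
  moreover have "range G \<approx> (UNIV :: real set)"
    using injG by (rule inj_on_image_eqpoll_self)
  ultimately have dim: "continuum_dim real_field (seq_space (L0 M)\<lparr>carrier := W\<rparr>)"
    unfolding continuum_dim_def by blast
  have "W - {\<zero>\<^bsub>seq_space (L0 M)\<^esub>} \<subseteq> S_p M - S_m M"
  proof
    fix v assume v: "v \<in> W - {\<zero>\<^bsub>seq_space (L0 M)\<^esub>}"
    then obtain a B where B: "finite B" "B \<subseteq> range G" "v = V.lincomb a B"
      unfolding W_def V.span_def by auto
    obtain T where T: "B = G ` T" "finite T"
      using finite_subset_image[OF B(1,2)] by auto
    show "v \<in> S_p M - S_m M"
    proof (cases "\<exists>t\<in>T. a (G t) \<noteq> 0")
      case True
      then show ?thesis using lincomb[of T a] T B by auto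
    next
      \<comment> \<open>If all coefficients vanish, then \<open>v\<close> is the zero vector, which
        has been removed from \<open>W\<close>.\<close>
      case False
      then have "V.lincomb a (G ` T) = seq_class M (\<lambda>n x. 0)"
        using lincomb_seq_class[of "bump_seq A L" M T a] meas T(2) injG
        unfolding G_def by (auto simp: inj_on_def inj_def)
      then show ?thesis using v B T by (simp add: zero_seq_space_L0)
    qed
  qed
  moreover have "Abstract_Topology.closure_of (L0_seq_topology M) W = topspace (L0_seq_topology M)"
  proof -
    have "\<exists>y\<in>W. y \<in> U" if U: "openin (L0_seq_topology M) U" "F \<in> U" for F U
    proof -
      obtain ds where ds: "ds \<in> lists D" and P: "\<And>f. \<forall>n. f n \<in> borel_measurable M \<Longrightarrow>
          \<forall>n<length ds. f n = ds ! n \<Longrightarrow> seq_class M f \<in> U"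
        using L0_seq_topology_meets_prescribed_initial_terms[OF D(2) U] by blast
      \<comment> \<open>The generator with initial segment \<open>ds\<close> lies in
        \<open>U\<close>, so no other element of the span is needed for density.\<close>
      obtain t where "L t = ds" using ds rL by (metis image_iff)
      then have "G t \<in> U" unfolding G_def
        by (intro P) (auto simp: meas, auto simp: bump_seq_def)
      then show ?thesis using GW by auto
    qed
    then show ?thesis unfolding closure_of_def by auto
  qed
  ultimately show ?thesis unfolding c_dense_lineable_def using sub dim by blast
qed

theorem theorem3p7:
  fixes M :: "'a measure"
  assumes "sigma_finite_measure M"
    and "\<exists>\<A>\<^sub>1. countable \<A>\<^sub>1 \<and> \<A>\<^sub>1 \<subseteq> sets M \<and>
      (\<forall>S \<in> sets M. emeasure M S < \<infinity> \<longrightarrow>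
        (\<forall>\<epsilon>::real. 0 < \<epsilon> \<longrightarrow> (\<exists>S\<^sub>0 \<in> \<A>\<^sub>1. emeasure M (sym_diff S S\<^sub>0) < ennreal \<epsilon>)))"
    and "\<exists>A :: nat \<Rightarrow> 'a set. range A \<subseteq> sets M \<and> disjoint_family A \<and> 0 < (INF n. emeasure M (A n))"
  shows "c_dense_lineable (S_p M - S_m M) (seq_space (L0 M)) (L0_seq_topology M) \<and>
    c_dense_lineable (S_p M - (\<Union>q\<in>{0<..}. S_L q M)) (seq_space (L0 M)) (L0_seq_topology M) \<and>
    c_dense_lineable (S_p M - S_c M) (seq_space (L0 M)) (L0_seq_topology M) \<and>
    c_dense_lineable (S_p M - S_au M) (seq_space (L0 M)) (L0_seq_topology M) \<and>
    c_dense_lineable (S_p M - S_u M) (seq_space (L0 M)) (L0_seq_topology M)"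
proof -
  obtain \<A> where \<A>: "countable \<A>" "\<A> \<subseteq> sets M"
    and dense: "\<And>S \<epsilon>::real. S \<in> sets M \<Longrightarrow> emeasure M S < \<infinity> \<Longrightarrow> 0 < \<epsilon> \<Longrightarrow>
      \<exists>S\<^sub>0 \<in> \<A>. emeasure M (sym_diff S S\<^sub>0) < ennreal \<epsilon>"
    using assms(2) by metis
  obtain A :: "nat \<Rightarrow> 'a set" where A: "range A \<subseteq> sets M" "disjoint_family A"
    "0 < (INF n. emeasure M (A n))"
    using assms(3) by metis
  note main = c_dense_lineable_S_p_minus_S_m[OF \<A> dense A]
  \<comment> \<open>Removing a smaller set leaves a larger one, so the subspace found for
    \<open>S_m\<close> serves for every \<open>S\<close> inside \<open>S_m\<close>.\<close>
  have mono: "c_dense_lineable (S_p M - S) (seq_space (L0 M)) (L0_seq_topology M)" if "S \<subseteq> S_m M" for S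
    by (rule c_dense_lineable_mono[OF main Diff_mono[OF order_refl that]])
  have "(\<Union>q\<in>{0<..}. S_L q M) \<subseteq> S_m M" by (intro UN_least S_L_subset_S_m) simp
  moreover have "S_u M \<subseteq> S_m M" using S_u_subset_S_au S_au_subset_S_m by (rule order_trans)
  ultimately show ?thesis
    by (intro conjI mono main S_c_subset_S_m S_au_subset_S_m)
qed

end
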